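(* Let $(\Omega,\Sigma,\mu)$ be a measure space and let $Y$ be a Banach space over $\mathbb K\in\{\mathbb R,\mathbb C\}$ with $\dim(Y)\geq2$. Then $$L_1(\mu)\widehat{\otimes}_\pi Y=\Big\{u=\sum_{i=1}^\infty f_i\otimes y_i\in L_1(\mu)\widehat{\otimes}_\pi Y:\ \mu(\operatorname{supp} f_i\cap\operatorname{supp} f_j)=0\ \ \forall i\neq j\Big\}$$ if and only if $\mu$ is purely atomic.
   Context: $L_1(\mu)\widehat{\otimes}_\pi Y$ is the projective tensor product, isometrically identified with the space $L_1(\mu,Y)$ of Bochner integrable functions via $(f\otimes y)(\omega)=f(\omega)y$; in the displayed set $f_i\in L_1(\mu)$, $y_i\in Y$ and sums converge in norm. $\operatorname{supp} f=\{\omega:f(\omega)\neq0\}$. Measurable sets are identified modulo null sets. A set $A\in\Sigma$ is an atom if $0<\mu(A)<\infty$ and every measurable $B\subseteq A$ has $\mu(B)=0$ or $\mu(B)=\mu(A)$. A set $E\in\Sigma$ with $0<\mu(E)<\infty$ is purely atomic if it coincides, modulo a null set, with the union of the (countably many, modulo null sets) atoms contained in $E$; $\mu$ is purely atomic if every $E\in\Sigma$ with $0<\mu(E)<\infty$ is purely atomic. *)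

theory Defs
  imports "HOL-Analysis.Analysis"
begin

section \<open>Banach spaces over the real or complex field\<close>

text \<open>The class \<open>banach\<close> provides real Banach spaces. A Banach space over \<open>'k\<close> (which will be
  \<open>real\<close> or \<open>complex\<close>) is a type of class \<open>banach\<close> with a scalar multiplication by \<open>'k\<close> that extends
  the one by reals and for which the given norm is homogeneous.\<close>

locale banach_space_over = vector_space smul
  for smul :: "'k::real_normed_field \<Rightarrow> 'y::banach \<Rightarrow> 'y" +
  assumes scale_of_real: "smul (of_real r) y = r *\<^sub>R y"
    and norm_scale: "norm (smul a y) = norm a * norm y"

lemma banach_space_over_scaleR: "banach_space_over (scaleR :: real \<Rightarrow> 'y::banach \<Rightarrow> 'y)"
  by unfold_locales (simp_all add: algebra_simps)

text \<open>The library's \<open>dim\<close> is \<open>0\<close> for infinite-dimensional spaces, which have to be included here.\<close>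

definition dim_ge :: "('k::field \<Rightarrow> 'y::ab_group_add \<Rightarrow> 'y) \<Rightarrow> nat \<Rightarrow> bool" where
  "dim_ge smul n \<longleftrightarrow> (\<exists>B. finite B \<and> card B = n \<and> \<not> module.dependent smul B)"

section \<open>Bochner integrable functions and the projective tensor product\<close>

text \<open>The library's \<open>integrable\<close> is available only for second countable (i.e. separable) spaces. The
  following is its definition without that restriction; the existence of \<open>L\<^sub>1\<close>-approximations by
  simple functions forces \<open>f\<close> to be almost everywhere separably valued.\<close>

definition bochner_integrable :: "'a measure \<Rightarrow> ('a \<Rightarrow> 'b::real_normed_vector) \<Rightarrow> bool" where
  "bochner_integrable M f \<longleftrightarrow> f \<in> borel_measurable M \<and>
     (\<exists>s. (\<forall>i. Bochner_Integration.simple_bochner_integrable M (s i)) \<and>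
          (\<lambda>i. \<integral>\<^sup>+x. ennreal (norm (f x - s i x)) \<partial>M) \<longlonglongrightarrow> 0)"

lemma bochner_integrable_iff_integrable:
  fixes f :: "'a \<Rightarrow> 'b::{banach, second_countable_topology}"
  shows "bochner_integrable M f \<longleftrightarrow> integrable M f"
proof
  assume "bochner_integrable M f"
  then show "integrable M f"
    unfolding bochner_integrable_def by (blast intro: integrableI_sequence)
next
  assume "integrable M f"
  then show "bochner_integrable M f"
    unfolding bochner_integrable_def integrable.simps has_bochner_integral.simps by blast
qed

text \<open>The projective tensor product \<open>L\<^sub>1(\<mu>) \<otimes>\<^sub>\<pi> Y\<close> under its isometric identification with
  \<open>L\<^sub>1(\<mu>, Y)\<close>, and the function that corresponds to \<open>f \<otimes> y\<close>. Elements of \<open>L\<^sub>1\<close> are given by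
  representatives: the two sets below are closed under almost everywhere equality of measurable
  functions, so that they are equal iff the corresponding sets of equivalence classes are.\<close>

definition L1_tensor :: "'a measure \<Rightarrow> ('a \<Rightarrow> 'y::banach) set" where
  "L1_tensor M = {u. bochner_integrable M u}"

definition elem_tensor :: "('k \<Rightarrow> 'y \<Rightarrow> 'y) \<Rightarrow> ('a \<Rightarrow> 'k) \<Rightarrow> 'y \<Rightarrow> 'a \<Rightarrow> 'y" where
  "elem_tensor smul f y = (\<lambda>\<omega>. smul (f \<omega>) y)"

definition supp :: "'a measure \<Rightarrow> ('a \<Rightarrow> 'k::zero) \<Rightarrow> 'a set" where
  "supp M f = {\<omega> \<in> space M. f \<omega> \<noteq> 0}"

definition disjoint_series ::
    "'a measure \<Rightarrow> ('k::{real_normed_field, second_countable_topology} \<Rightarrow> 'y::banach \<Rightarrow> 'y) \<Rightarrow>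
     ('a \<Rightarrow> 'y) set" where
  "disjoint_series M smul = {u \<in> L1_tensor M. \<exists>(f :: nat \<Rightarrow> 'a \<Rightarrow> 'k) (y :: nat \<Rightarrow> 'y).
     (\<forall>i. integrable M (f i)) \<and>
     (\<lambda>n. \<integral>\<^sup>+\<omega>. ennreal (norm (u \<omega> - (\<Sum>i<n. elem_tensor smul (f i) (y i) \<omega>))) \<partial>M) \<longlonglongrightarrow> 0 \<and>
     (\<forall>i j. i \<noteq> j \<longrightarrow> emeasure M (supp M (f i) \<inter> supp M (f j)) = 0)}"

section \<open>Purely atomic measures\<close>

definition is_atom :: "'a measure \<Rightarrow> 'a set \<Rightarrow> bool" where
  "is_atom M A \<longleftrightarrow> A \<in> sets M \<and> 0 < emeasure M A \<and> emeasure M A < \<infinity> \<and>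
     (\<forall>B\<in>sets M. B \<subseteq> A \<longrightarrow> emeasure M B = 0 \<or> emeasure M B = emeasure M A)"

text \<open>The atoms in \<open>E\<close> have to be counted, and their union formed, modulo null sets: adding
  a null set to an atom gives an atom again, so that the union of all sets that are atoms may be much
  too large. Hence \<open>\<A>\<close> is a countable set of representatives of the atoms contained in \<open>E\<close>.\<close>

definition purely_atomic_set :: "'a measure \<Rightarrow> 'a set \<Rightarrow> bool" where
  "purely_atomic_set M E \<longleftrightarrow> (\<exists>\<A>. countable \<A> \<and>
     (\<forall>A\<in>\<A>. is_atom M A \<and> A \<subseteq> E) \<and>
     (\<forall>A. is_atom M A \<and> A \<subseteq> E \<longrightarrow> (\<exists>B\<in>\<A>. (A - B) \<union> (B - A) \<in> null_sets M)) \<and>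
     E - \<Union>\<A> \<in> null_sets M)"

definition purely_atomic :: "'a measure \<Rightarrow> bool" where
  "purely_atomic M \<longleftrightarrow>
     (\<forall>E\<in>sets M. 0 < emeasure M E \<and> emeasure M E < \<infinity> \<longrightarrow> purely_atomic_set M E)"

end

theory Submission
  imports Defs
begin

text \<open>If \<open>\<mu>\<close> is purely atomic, an integrable \<open>u\<close> vanishes outside countably many atoms, and it is
  almost everywhere constant on each of them; this is a disjoint series of indicators.

  Conversely, let \<open>E\<close> have finite measure. There is a bounded measurable \<open>g\<close> each of whose level sets
  in \<open>E\<close> is null or an atom. Take linearly independent \<open>p, q\<close> and expand \<open>u = 1\<^sub>E (p + g q)\<close> as a disjoint
  series: almost every value of \<open>u\<close> on \<open>E\<close> is a nonzero multiple of one of countably many vectors, and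
  \<open>p + s q\<close>, \<open>p + t q\<close> are parallel only if \<open>s = t\<close>. So countably many level sets of \<open>g\<close> cover \<open>E\<close> up to
  a null set, and those of positive measure are the atoms.\<close>

section \<open>Splitting a set of finite measure into null sets and atoms\<close>

text \<open>At the first index \<open>N\<close> where the digits differ, one series gains
  \<open>(1/3)^N\<close>, while all later digits of the other add up to at most half of that. Base 3
  with digits 0 and 1 thus avoids the ambiguity of binary expansions, and an infinite sequence of
  binary choices can be stored in one real number.\<close>

lemma ternary_series_inj:
  fixes a b :: "nat \<Rightarrow> bool"
  assumes eq: "(\<Sum>n. if a n then (1/3::real)^n else 0) = (\<Sum>n. if b n then (1/3)^n else 0)"
  shows "a = b"
proof (rule ccontr)
  have summ: "summable (\<lambda>n. if c n then (1/3::real)^n else 0)" for c :: "nat \<Rightarrow> bool"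
    by (rule summable_comparison_test'[of "\<lambda>n. (1/3::real)^n" 0]) auto
  have summ': "summable (\<lambda>n. if c (n + k) then (1/3::real)^(n + k) else 0)" for c :: "nat \<Rightarrow> bool" and k
    by (rule summable_ignore_initial_segment[OF summ])
  \<comment> \<open>Stated for arbitrary \<open>c\<close> and \<open>d\<close>, since either of
    \<open>a\<close> and \<open>b\<close> may be the one with digit 1 at the first
    difference.\<close>
  have less: "(\<Sum>n. if d n then (1/3::real)^n else 0) < (\<Sum>n. if c n then (1/3)^n else 0)"
    if N: "c N" "\<not> d N" and below: "\<And>n. n < N \<Longrightarrow> c n = d n" for c d :: "nat \<Rightarrow> bool" and N
  proof -
    let ?t = "\<lambda>c n. if c n then (1/3::real)^n else 0"
    have "(\<Sum>n<N. ?t c n) = (\<Sum>n<N. ?t d n)"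
      using below by (intro sum.cong) auto
    then have head: "(\<Sum>n<Suc N. ?t c n) = (\<Sum>n<Suc N. ?t d n) + (1/3)^N"
      using N by simp
    have "(\<Sum>n. ?t d (n + Suc N)) \<le> (\<Sum>n. (1/3)^Suc N * (1/3)^n)"
      by (intro suminf_le summable_mult summ') (auto simp: power_add)
    also have "\<dots> = (1/3)^N / 2"
      by (subst suminf_mult) (auto simp: suminf_geometric)
    finally have tail_d: "(\<Sum>n. ?t d (n + Suc N)) \<le> (1/3)^N / 2" .
    have tail_c: "0 \<le> (\<Sum>n. ?t c (n + Suc N))"
      by (intro suminf_nonneg summ') auto
    have split: "(\<Sum>n. ?t e n) = (\<Sum>n. ?t e (n + Suc N)) + (\<Sum>n<Suc N. ?t e n)" for e
      by (rule suminf_split_initial_segment[OF summ])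
    have "(0::real) < (1/3)^N" by simp
    then show ?thesis
      using head tail_c tail_d split[of c] split[of d] by linarith
  qed
  assume "a \<noteq> b"
  then obtain m where "a m \<noteq> b m" by auto
  define N where "N = (LEAST n. a n \<noteq> b n)"
  have N: "a N \<noteq> b N" unfolding N_def by (rule LeastI) fact
  have below: "a n = b n" if "n < N" for n
    using not_less_Least that unfolding N_def by blast
  show False
  proof (cases "a N")
    case True
    then show False using less[of a N b] N below eq by auto
  next
    case False
    then show False using less[of b N a] N below eq by auto
  qed
qed

text \<open>The smaller of the two pieces measures how even a cut is. Its supremum over all cuts may
  fail to be attained; the factor 2 makes some cut good enough, and the empty set serves when the
  supremum is zero.\<close>

lemma ex_balanced_subset:
  assumes "B \<in> fmeasurable M"
  shows "\<exists>C\<in>sets M. C \<subseteq> B \<and> (\<forall>D\<in>sets M. D \<subseteq> B \<longrightarrow>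
    min (measure M D) (measure M (B - D)) \<le> 2 * min (measure M C) (measure M (B - C)))"
proof -
  define m where "m D = min (measure M D) (measure M (B - D))" for D
  define K where "K = {D \<in> sets M. D \<subseteq> B}"
  have K: "{} \<in> K" by (auto simp: K_def)
  have bdd: "bdd_above (m ` K)"
    using assms by (intro bdd_aboveI2[of _ _ "measure M B"])
      (auto simp: m_def K_def intro!: min.coboundedI1 measure_mono_fmeasurable)
  have upper: "m D \<le> Sup (m ` K)" if "D \<in> K" for D
    using bdd that by (rule cSUP_upper2) simp
  have "\<exists>C\<in>K. Sup (m ` K) \<le> 2 * m C"
  proof (cases "Sup (m ` K) \<le> 0")
    case True
    have "0 \<le> m {}" by (simp add: m_def)
    with True K show ?thesis by force
  next
    case False
    then have "Sup (m ` K) / 2 < Sup (m ` K)" by simp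
    then obtain C where "C \<in> K" "Sup (m ` K) / 2 < m C"
      using K by (subst (asm) less_cSUP_iff[OF _ bdd]) auto
    then show ?thesis by force
  qed
  then obtain C where C: "C \<in> K" "Sup (m ` K) \<le> 2 * m C" by blast
  have "m D \<le> 2 * m C" if "D \<in> K" for D
    using upper[OF that] C(2) by linarith
  with C(1) show ?thesis
    unfolding K_def m_def by blast
qed

text \<open>Suppose the intersection splits into two parts of measure at least
  \<open>\<delta> > 0\<close>. The same \<open>D\<close> then competes with every cut
  \<open>C n\<close>, so both pieces of each cut have measure at least \<open>\<delta> / 2\<close>.
  Whichever piece is kept, each step loses at least \<open>\<delta> / 2\<close>, which the finite
  measure of \<open>S 0\<close> cannot sustain.\<close>

lemma Int_halving_chain_null_or_atom:
  fixes S :: "nat \<Rightarrow> 'a set"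
  assumes S: "\<And>n. S n \<in> fmeasurable M"
    and C: "\<And>n. C n \<in> sets M" "\<And>n. C n \<subseteq> S n"
    and balanced: "\<And>n D. D \<in> sets M \<Longrightarrow> D \<subseteq> S n \<Longrightarrow>
      min (measure M D) (measure M (S n - D)) \<le> 2 * min (measure M (C n)) (measure M (S n - C n))"
    and step: "\<And>n. S (Suc n) = C n \<or> S (Suc n) = S n - C n"
  shows "(\<Inter>n. S n) \<in> null_sets M \<or> is_atom M (\<Inter>n. S n)"
proof -
  let ?L = "\<Inter>n. S n"
  have L: "?L \<in> fmeasurable M"
    using S by (intro fmeasurable_INT[where I=UNIV and i=0]) auto
  have fm: "D \<in> fmeasurable M" if "D \<in> sets M" "D \<subseteq> S n" for D n
    using S that by (meson fmeasurableI2)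
  have D: "measure M D = 0 \<or> measure M (?L - D) = 0" if D: "D \<in> sets M" "D \<subseteq> ?L" for D
  proof (rule ccontr)
    assume neg: "\<not> ?thesis"
    define \<delta> where "\<delta> = min (measure M D) (measure M (?L - D))"
    have \<delta>: "\<delta> > 0" using neg by (auto simp: \<delta>_def zero_less_measure_iff)
    have decr: "measure M (S (Suc n)) \<le> measure M (S n) - \<delta> / 2" for n
    proof -
      have "measure M (?L - D) \<le> measure M (S n - D)"
        using D L S by (intro measure_mono_fmeasurable) (auto intro: fmeasurable.Diff fm[of _ n])
      then have "\<delta> / 2 \<le> min (measure M (C n)) (measure M (S n - C n))"
        using balanced[of D n] D INT_lower[of n UNIV S]
        by (fastforce simp: \<delta>_def)
      moreover have S_C: "measure M (S n - C n) = measure M (S n) - measure M (C n)"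
        using S[of n] C fm[of "C n" n] by (intro measure_Diff) (auto simp: fmeasurable_def)
      ultimately have "\<delta> / 2 \<le> measure M (C n)" "measure M (C n) \<le> measure M (S n) - \<delta> / 2"
        by auto
      with S_C show ?thesis using step[of n] by auto
    qed
    have bound: "measure M (S n) \<le> measure M (S 0) - n * (\<delta> / 2)" for n
    proof (induction n)
      case (Suc n)
      then show ?case using decr[of n] by (simp add: algebra_simps add_divide_distrib)
    qed simp
    obtain n :: nat where "measure M (S 0) < n * (\<delta> / 2)"
      using \<delta> ex_less_of_nat_mult[of "\<delta> / 2"] by auto
    with bound[of n] show False
      using measure_nonneg[of M "S n"] by linarith
  qed
  show ?thesis
  proof (cases "?L \<in> null_sets M")
    case False
    have "emeasure M D = 0 \<or> emeasure M D = emeasure M ?L" if D': "D \<in> sets M" "D \<subseteq> ?L" for D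
    proof -
      have D'': "D \<in> fmeasurable M" using fm[of D 0] D' by auto
      have "measure M (?L - D) = measure M ?L - measure M D"
        using D' L D'' by (intro measure_Diff) (auto simp: fmeasurable_def)
      with D[OF D'] have "measure M D = 0 \<or> measure M D = measure M ?L" by auto
      then show ?thesis using D'' L by (auto simp: emeasure_eq_measure2)
    qed
    then show ?thesis using False L
      by (auto simp: is_atom_def fmeasurable_def null_sets_def zero_less_iff_neq_zero)
  qed simp
qed

text \<open>Cut \<open>E\<close> repeatedly into two pieces, as evenly as possible up to a factor 2, and let \<open>g x\<close> record
  the pieces that \<open>x\<close> falls into. A level set of \<open>g\<close> that could still be split into two sets of positive
  measure would have made every cut along its branch remove a fixed amount of measure.\<close>

lemma ex_function_level_sets_null_or_atom:
  assumes E: "E \<in> fmeasurable M"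
  shows "\<exists>g :: 'a \<Rightarrow> real. g \<in> borel_measurable M \<and> (\<forall>x. \<bar>g x\<bar> \<le> 3/2) \<and>
    (\<forall>c. {x\<in>E. g x = c} \<in> null_sets M \<or> is_atom M {x\<in>E. g x = c})"
proof -
  define h where "h B = (SOME C. C \<in> sets M \<and> C \<subseteq> B \<and> (\<forall>D\<in>sets M. D \<subseteq> B \<longrightarrow>
      min (measure M D) (measure M (B - D)) \<le> 2 * min (measure M C) (measure M (B - C))))" for B
  have h: "\<And>B. B \<in> fmeasurable M \<Longrightarrow> h B \<in> sets M \<and> h B \<subseteq> B \<and> (\<forall>D\<in>sets M. D \<subseteq> B \<longrightarrow>
      min (measure M D) (measure M (B - D)) \<le> 2 * min (measure M (h B)) (measure M (B - h B)))"
    unfolding h_def by (rule someI_ex, drule ex_balanced_subset) blast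
  \<comment> \<open>For \<open>x\<close> in \<open>E\<close>, \<open>P n x\<close> is the cell
    containing \<open>x\<close> after \<open>n\<close> rounds of cuts. A point outside
    \<open>E\<close> always follows the complements, so \<open>P n\<close> is total and still takes
    only finitely many values.\<close>
  define P :: "nat \<Rightarrow> 'a \<Rightarrow> 'a set" where
    "P n x = rec_nat E (\<lambda>_ B. if x \<in> h B then h B else B - h B) n" for n x
  have P0: "P 0 x = E" and PS: "P (Suc n) x = (if x \<in> h (P n x) then h (P n x) else P n x - h (P n x))"
    for n x by (simp_all add: P_def)
  have fin: "finite (range (P n))" for n
  proof (induction n)
    case (Suc n)
    have "range (P (Suc n)) \<subseteq> h ` range (P n) \<union> (\<lambda>B. B - h B) ` range (P n)"
      by (auto simp: PS)
    then show ?case using Suc finite_subset by blast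
  qed (simp add: P0)
  have fm: "P n x \<in> fmeasurable M" for n x
  proof (induction n)
    case (Suc n)
    have "h (P n x) \<in> fmeasurable M"
      using Suc h[OF Suc] by (meson fmeasurableI2)
    then show ?case using Suc by (auto simp: PS fmeasurable.Diff)
  qed (simp add: P0 E)
  \<comment> \<open>The cell is treated as a value in a finite discrete space. The next cell depends
    on \<open>x\<close> through the current cell and through membership in its cut; with the current
    cell frozen to \<open>B\<close>, only membership in the measurable set \<open>h B\<close>
    remains.\<close>
  have meas: "P n \<in> measurable M (count_space (range (P n)))" for n
  proof (induction n)
    case 0
    then show ?case by (auto simp: P0[abs_def])
  next
    case (Suc n)
    have "(\<lambda>x. (\<lambda>B x. if x \<in> h B then h B else B - h B) (P n x) x) \<in> measurable M (count_space UNIV)"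
    proof (rule measurable_compose_countable'[OF _ Suc])
      fix B assume "B \<in> range (P n)"
      then have [measurable]: "h B \<in> sets M" using h fm by auto
      show "(\<lambda>x. if x \<in> h B then h B else B - h B) \<in> measurable M (count_space UNIV)"
        by measurable
    qed (use fin countable_finite in blast)
    then have "P (Suc n) \<in> measurable M (count_space UNIV)"
      by (simp add: PS[abs_def])
    then show ?case
      unfolding measurable_count_space_eq2[OF fin] using measurable_sets by fastforce
  qed
  define b where "b n x \<longleftrightarrow> x \<in> h (P n x)" for n x
  have [measurable]: "Measurable.pred M (b n)" for n
    unfolding b_def
  proof (rule measurable_compose_countable'[OF _ meas])
    fix B assume "B \<in> range (P n)"
    then have [measurable]: "h B \<in> sets M" using h fm by auto
    show "Measurable.pred M (\<lambda>x. x \<in> h B)" by measurable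
  qed (use fin countable_finite in blast)
  \<comment> \<open>The left/right choices of \<open>x\<close> become the ternary digits of
    \<open>g x\<close>; the bound 3/2 is the sum of the geometric series.\<close>
  define g where "g x = (\<Sum>n. if b n x then (1/3::real)^n else 0)" for x
  have "g \<in> borel_measurable M" unfolding g_def by measurable
  moreover have "\<bar>g x\<bar> \<le> 3/2" for x
  proof -
    have s: "summable (\<lambda>n. if b n x then (1/3::real)^n else 0)"
      by (rule summable_comparison_test'[of "\<lambda>n. (1/3::real)^n" 0]) auto
    have "g x \<le> (\<Sum>n. (1/3::real)^n)" unfolding g_def by (intro suminf_le s) auto
    moreover have "0 \<le> g x" unfolding g_def by (intro suminf_nonneg s) auto
    ultimately show ?thesis by (simp add: suminf_geometric)
  qed
  moreover have "{x\<in>E. g x = c} \<in> null_sets M \<or> is_atom M {x\<in>E. g x = c}" for c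
  proof (cases "{x\<in>E. g x = c} = {}")
    case False
    then obtain z where z: "z \<in> E" "g z = c" by auto
    have self: "x \<in> P n x" if "x \<in> E" for n x
      using that by (induction n) (auto simp: P0 PS)
    have same: "P n x = P n z" if "\<And>n. b n x = b n z" for n x
    proof (induction n)
      case (Suc n)
      then show ?case using that[of n] by (simp add: b_def PS)
    qed (simp add: P0)
    have branch: "P n x = P n z" if "\<And>n. x \<in> P n z" for n x
    proof (induction n)
      case (Suc n)
      then show ?case using that[of "Suc n"] by (auto simp: PS split: if_splits)
    qed (simp add: P0)
    have bits: "b n x = b n z" if "\<And>n. x \<in> P n z" for n x
      using branch[OF that, of n] that[of "Suc n"] by (auto simp: PS b_def split: if_splits)
    \<comment> \<open>Equal values of \<open>g\<close> mean equal digits, and the digits determine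
      all cells. Conversely, lying in every cell of \<open>z\<close> forces the same choices. So a
      nonempty level set is the intersection of one branch of cells.\<close>
    have "{x\<in>E. g x = c} = (\<Inter>n. P n z)"
    proof (intro set_eqI iffI)
      fix x assume x: "x \<in> {x\<in>E. g x = c}"
      then have "(\<lambda>n. b n x) = (\<lambda>n. b n z)"
        using z by (intro ternary_series_inj) (simp add: g_def)
      then have "b n x = b n z" for n by (rule fun_cong)
      then have "P n x = P n z" for n by (rule same)
      then show "x \<in> (\<Inter>n. P n z)" using self x by (metis (no_types, lifting) INT_I mem_Collect_eq)
    next
      fix x assume "x \<in> (\<Inter>n. P n z)"
      then have x: "x \<in> P n z" for n by auto
      show "x \<in> {x\<in>E. g x = c}"
        using bits[OF x] x[of 0] z by (simp add: P0 g_def)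
    qed
    moreover have "(\<Inter>n. P n z) \<in> null_sets M \<or> is_atom M (\<Inter>n. P n z)"
      by (rule Int_halving_chain_null_or_atom[where C="\<lambda>n. h (P n z)"])
         (use fm h in \<open>auto simp: PS\<close>)
    ultimately show ?thesis by simp
  next
    case True
    show ?thesis unfolding True by simp
  qed
  ultimately show ?thesis by blast
qed

section \<open>Almost everywhere values of a disjoint series\<close>

text \<open>In a non-separable space Borel measurability is not preserved by sums; being a pointwise limit of
  simple functions is.\<close>

definition simple_limit :: "'a measure \<Rightarrow> ('a \<Rightarrow> 'b::real_normed_vector) \<Rightarrow> bool" where
  "simple_limit M h \<longleftrightarrow>
     (\<exists>s. (\<forall>i::nat. simple_function M (s i)) \<and> (\<forall>x\<in>space M. (\<lambda>i. s i x) \<longlonglongrightarrow> h x))"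

lemma simple_limit_measurable:
  assumes "simple_limit M h"
  shows "h \<in> borel_measurable M"
proof -
  obtain s where s: "\<And>i::nat. simple_function M (s i)" "\<And>x. x \<in> space M \<Longrightarrow> (\<lambda>i. s i x) \<longlonglongrightarrow> h x"
    using assms unfolding simple_limit_def by blast
  show ?thesis
    by (rule borel_measurable_LIMSEQ_metric[OF borel_measurable_simple_function[OF s(1)] s(2)])
qed

lemma simple_limit_add:
  assumes "simple_limit M g" "simple_limit M h"
  shows "simple_limit M (\<lambda>x. g x + h x)"
proof -
  obtain s t where "\<And>i::nat. simple_function M (s i)" "\<And>x. x \<in> space M \<Longrightarrow> (\<lambda>i. s i x) \<longlonglongrightarrow> g x"
    "\<And>i::nat. simple_function M (t i)" "\<And>x. x \<in> space M \<Longrightarrow> (\<lambda>i. t i x) \<longlonglongrightarrow> h x"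
    using assms unfolding simple_limit_def by blast
  then show ?thesis
    unfolding simple_limit_def
    by (intro exI[of _ "\<lambda>i x. s i x + t i x"]) (auto intro: simple_function_compose2 tendsto_add)
qed

text \<open>Separability is needed only for the values of \<open>f\<close>, where simple
  approximations exist; \<open>T\<close> carries them continuously into a space that may be
  non-separable.\<close>

lemma simple_limit_bounded_linear:
  fixes f :: "'a \<Rightarrow> 'b::{real_normed_vector, second_countable_topology}"
  assumes "f \<in> borel_measurable M" "bounded_linear T"
  shows "simple_limit M (\<lambda>x. T (f x))"
proof -
  obtain s where "\<And>i::nat. simple_function M (s i)" "\<And>x. x \<in> space M \<Longrightarrow> (\<lambda>i. s i x) \<longlonglongrightarrow> f x"
    using borel_measurable_implies_sequence_metric[OF assms(1), of 0] by metis
  then show ?thesis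
    unfolding simple_limit_def
    by (intro exI[of _ "\<lambda>i x. T (s i x)"])
       (auto intro: simple_function_compose1 bounded_linear.tendsto[OF assms(2)])
qed

lemma simple_limit_scaleR_add:
  fixes f g :: "'a \<Rightarrow> real"
  assumes "f \<in> borel_measurable M" "g \<in> borel_measurable M"
  shows "simple_limit M (\<lambda>x. f x *\<^sub>R y + g x *\<^sub>R y')"
  using assms by (intro simple_limit_add simple_limit_bounded_linear[OF _ bounded_linear_scaleR_left])

lemma bounded_linear_smul_left:
  fixes smul :: "'k::real_normed_field \<Rightarrow> 'y::banach \<Rightarrow> 'y"
  assumes "banach_space_over smul"
  shows "bounded_linear (\<lambda>a. smul a y)"
proof -
  interpret banach_space_over smul by fact
  show ?thesis
    by (intro bounded_linear_intro[where K="norm y"])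
       (auto simp: scale_left_distrib norm_scale scaleR_conv_of_real[where 'a='k]
         scale_scale[symmetric] scale_of_real simp del: scale_scale)
qed

text \<open>The partial sums are eventually constant at almost every point, so Fatou's lemma identifies
  the sum without passing to a subsequence.\<close>

lemma disjoint_series_AE:
  fixes smul :: "'k::{real_normed_field, second_countable_topology} \<Rightarrow> 'y::banach \<Rightarrow> 'y"
  assumes "banach_space_over smul" and u: "simple_limit M u" "u \<in> disjoint_series M smul"
  obtains f :: "nat \<Rightarrow> 'a \<Rightarrow> 'k" and z :: "nat \<Rightarrow> 'y"
  where "AE x in M. u x \<noteq> 0 \<longrightarrow> (\<exists>i. f i x \<noteq> 0 \<and> u x = smul (f i x) (z i))"
proof -
  interpret banach_space_over smul by fact
  obtain f :: "nat \<Rightarrow> 'a \<Rightarrow> 'k" and z :: "nat \<Rightarrow> 'y"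
    where f: "\<And>i. integrable M (f i)"
      and lim: "(\<lambda>n. \<integral>\<^sup>+\<omega>. ennreal (norm (u \<omega> - (\<Sum>i<n. elem_tensor smul (f i) (z i) \<omega>))) \<partial>M) \<longlonglongrightarrow> 0"
      and disj: "\<And>i j. i \<noteq> j \<Longrightarrow> emeasure M (supp M (f i) \<inter> supp M (f j)) = 0"
    using u(2) unfolding disjoint_series_def by auto
  have [measurable]: "f i \<in> borel_measurable M" for i using f by auto
  define S where "S n x = (\<Sum>i<n. smul (f i x) (z i))" for n x
  have "simple_limit M (\<lambda>x. u x - S n x)" for n
  proof (induction n)
    case 0
    then show ?case using u by (simp add: S_def)
  next
    case (Suc n)
    \<comment> \<open>The sign is absorbed into the linear map, so that closure under sums handles
      the subtraction.\<close>
    have "bounded_linear (\<lambda>a. - smul a (z n))"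
      using bounded_linear_smul_left[OF assms(1)] by (rule bounded_linear_minus)
    then have "simple_limit M (\<lambda>x. (u x - S n x) + - smul (f n x) (z n))"
      by (intro simple_limit_add Suc simple_limit_bounded_linear[where T="\<lambda>a. - smul a (z n)"]) auto
    then show ?case by (simp add: S_def algebra_simps)
  qed
  from simple_limit_measurable[OF this]
  have [measurable]: "(\<lambda>x. u x - S n x) \<in> borel_measurable M" for n .
  have "(\<integral>\<^sup>+x. liminf (\<lambda>n. ennreal (norm (u x - S n x))) \<partial>M) \<le>
      liminf (\<lambda>n. \<integral>\<^sup>+x. ennreal (norm (u x - S n x)) \<partial>M)"
    by (rule nn_integral_liminf) measurable
  also have "\<dots> = 0"
    using lim by (intro lim_imp_Liminf) (auto simp: S_def elem_tensor_def)
  finally have "AE x in M. liminf (\<lambda>n. ennreal (norm (u x - S n x))) = 0"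
    by (subst (asm) le_zero_eq, subst (asm) nn_integral_0_iff_AE) auto
  moreover have "AE x in M. \<forall>i j. i \<noteq> j \<longrightarrow> f i x = 0 \<or> f j x = 0"
    unfolding AE_all_countable
  proof (intro allI)
    fix i j
    show "AE x in M. i \<noteq> j \<longrightarrow> f i x = 0 \<or> f j x = 0"
    proof (cases "i = j")
      case False
      have "supp M (f i) \<inter> supp M (f j) \<in> null_sets M"
        using disj[OF False] unfolding supp_def by (intro null_setsI) measurable
      from AE_not_in[OF this] show ?thesis
        by (rule AE_mp) (auto simp: supp_def)
    qed simp
  qed
  ultimately have "AE x in M. u x \<noteq> 0 \<longrightarrow> (\<exists>i. f i x \<noteq> 0 \<and> u x = smul (f i x) (z i))"
  proof eventually_elim
    case (elim x)
    have *: "u x = v" if "\<And>n. n > i \<Longrightarrow> S n x = v" for i v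
    proof -
      have "(\<lambda>n. ennreal (norm (u x - S n x))) \<longlonglongrightarrow> ennreal (norm (u x - v))"
        by (rule tendsto_eventually, rule eventually_mono[OF eventually_gt_at_top[of i]])
           (simp add: that)
      from lim_imp_Liminf[OF _ this] elim(1) have "ennreal (norm (u x - v)) = 0" by simp
      then show ?thesis by simp
    qed
    show ?case
    proof (cases "\<exists>i. f i x \<noteq> 0")
      case True
      then obtain i where i: "f i x \<noteq> 0" by auto
      have zero: "f j x = 0" if "j \<noteq> i" for j
        using elim(2) i that by metis
      have "S n x = smul (f i x) (z i)" if "n > i" for n
      proof -
        have "S n x = (\<Sum>j\<in>{i}. smul (f j x) (z j))"
          unfolding S_def using that zero by (intro sum.mono_neutral_right) auto
        then show ?thesis by simp
      qed
      from *[OF this] i show ?thesis by auto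
    next
      case False
      then have "S n x = 0" for n by (simp add: S_def)
      from *[OF this] show ?thesis by simp
    qed
  qed
  then show ?thesis by (rule that)
qed

section \<open>From disjoint expansions to pure atomicity\<close>

text \<open>A non-null intersection has full measure in each of the two atoms, and since these
  measures are finite, both differences are null.\<close>

lemma is_atom_Int_null_sets:
  assumes "is_atom M A" "is_atom M B" "A \<inter> B \<notin> null_sets M"
  shows "(A - B) \<union> (B - A) \<in> null_sets M"
proof -
  have "A - B \<in> null_sets M" if "is_atom M A" "is_atom M B" "A \<inter> B \<notin> null_sets M" for A B
  proof -
    have m: "A \<in> sets M" "B \<in> sets M" using that by (auto simp: is_atom_def)
    then have "emeasure M (A \<inter> B) = emeasure M A"
      using that unfolding is_atom_def by (metis Int_lower1 null_setsI sets.Int)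
    moreover have "emeasure M A < \<infinity>" using that by (simp add: is_atom_def)
    ultimately have "emeasure M (A - A \<inter> B) = 0"
      using m by (subst emeasure_Diff) auto
    then show ?thesis using m by (intro null_setsI) (auto simp: Diff_Int)
  qed
  from this[OF assms] this[OF assms(2,1)] assms(3) show ?thesis
    by (auto simp: Int_commute)
qed

text \<open>Simple approximations of the two coefficients combine to approximations
  \<open>?w\<close> of the vector function, with error at most the coefficient errors weighted by
  \<open>norm y\<close> and \<open>norm y'\<close>. This puts the test function
  \<open>1\<^sub>E (p + g q)\<close> into \<open>L1_tensor M\<close>.\<close>

lemma bochner_integrable_pair:
  fixes g :: "'a \<Rightarrow> real" and y y' :: "'y::real_normed_vector"
  assumes f: "integrable M f" and g: "integrable M g"
  shows "bochner_integrable M (\<lambda>x. f x *\<^sub>R y + g x *\<^sub>R y')" (is "bochner_integrable M ?u")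
proof -
  from f obtain s where s: "\<And>i. Bochner_Integration.simple_bochner_integrable M (s i)"
      "(\<lambda>i. \<integral>\<^sup>+x. ennreal (norm (f x - s i x)) \<partial>M) \<longlonglongrightarrow> 0"
    by (auto simp: bochner_integrable_iff_integrable[symmetric] bochner_integrable_def)
  from g obtain t where t: "\<And>i. Bochner_Integration.simple_bochner_integrable M (t i)"
      "(\<lambda>i. \<integral>\<^sup>+x. ennreal (norm (g x - t i x)) \<partial>M) \<longlonglongrightarrow> 0"
    by (auto simp: bochner_integrable_iff_integrable[symmetric] bochner_integrable_def)
  have [measurable]: "f \<in> borel_measurable M" "g \<in> borel_measurable M" using f g by auto
  have [measurable]: "s i \<in> borel_measurable M" "t i \<in> borel_measurable M" for i
    using s(1)[of i] t(1)[of i]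
    by (auto elim!: Bochner_Integration.simple_bochner_integrable.cases intro: borel_measurable_simple_function)
  let ?w = "\<lambda>i x. s i x *\<^sub>R y + t i x *\<^sub>R y'"
  have le: "(\<integral>\<^sup>+x. ennreal (norm (?u x - ?w i x)) \<partial>M) \<le>
     ennreal (norm y) * (\<integral>\<^sup>+x. ennreal (norm (f x - s i x)) \<partial>M) +
     ennreal (norm y') * (\<integral>\<^sup>+x. ennreal (norm (g x - t i x)) \<partial>M)" for i
  proof -
    have "norm (?u x - ?w i x) \<le> norm y * norm (f x - s i x) + norm y' * norm (g x - t i x)" for x
    proof -
      have "?u x - ?w i x = (f x - s i x) *\<^sub>R y + (g x - t i x) *\<^sub>R y'"
        by (simp add: algebra_simps)
      then show ?thesis
        using norm_triangle_ineq[of "(f x - s i x) *\<^sub>R y" "(g x - t i x) *\<^sub>R y'"]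
        by (simp add: mult.commute)
    qed
    then have "(\<integral>\<^sup>+x. ennreal (norm (?u x - ?w i x)) \<partial>M) \<le>
       (\<integral>\<^sup>+x. ennreal (norm y) * ennreal (norm (f x - s i x)) + ennreal (norm y') * ennreal (norm (g x - t i x)) \<partial>M)"
      by (intro nn_integral_mono) (simp flip: ennreal_mult' ennreal_plus)
    then show ?thesis
      by (simp add: nn_integral_add nn_integral_cmult)
  qed
  have "(\<lambda>i. ennreal (norm y) * (\<integral>\<^sup>+x. ennreal (norm (f x - s i x)) \<partial>M) +
     ennreal (norm y') * (\<integral>\<^sup>+x. ennreal (norm (g x - t i x)) \<partial>M)) \<longlonglongrightarrow> ennreal (norm y) * 0 + ennreal (norm y') * 0"
    by (intro tendsto_add ennreal_tendsto_cmult s t) auto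
  then have "(\<lambda>i. ennreal (norm y) * (\<integral>\<^sup>+x. ennreal (norm (f x - s i x)) \<partial>M) +
     ennreal (norm y') * (\<integral>\<^sup>+x. ennreal (norm (g x - t i x)) \<partial>M)) \<longlonglongrightarrow> 0"
    by simp
  then have lim: "(\<lambda>i. \<integral>\<^sup>+x. ennreal (norm (?u x - ?w i x)) \<partial>M) \<longlonglongrightarrow> 0"
    by (rule tendsto_sandwich[OF always_eventually always_eventually tendsto_const, rotated 2])
       (use le in auto)
  have simple: "Bochner_Integration.simple_bochner_integrable M (?w i)" for i
    by (rule Bochner_Integration.simple_bochner_integrable_compose2[where p="\<lambda>a b. a *\<^sub>R y + b *\<^sub>R y'"])
       (simp_all add: s t)
  have "?u \<in> borel_measurable M"
    by (rule simple_limit_measurable, rule simple_limit_scaleR_add) measurable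
  then show ?thesis
    unfolding bochner_integrable_def by (rule conjI[OF _ exI[of _ ?w]]) (simp add: lim simple)
qed

lemma purely_atomic_if_disjoint_series:
  fixes smul :: "'k::{real_normed_field, second_countable_topology} \<Rightarrow> 'y::banach \<Rightarrow> 'y"
  assumes "banach_space_over smul" "dim_ge smul 2" "L1_tensor M = disjoint_series M smul"
  shows "purely_atomic M"
  unfolding purely_atomic_def
proof (intro ballI impI)
  interpret banach_space_over smul by fact
  obtain B where B: "finite B" "card B = 2" "\<not> dependent B"
    using assms(2) by (auto simp: dim_ge_def)
  then obtain p q where pq: "B = {p, q}" "p \<noteq> q" by (auto simp: card_2_iff)
  have indep: "a = 0 \<and> b = 0" if "smul a p + smul b q = 0" for a b
  proof -
    let ?c = "\<lambda>v. if v = p then a else b"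
    have "(\<Sum>v\<in>B. smul (?c v) v) = 0" using that pq by simp
    then have "?c v = 0" if "v \<in> B" for v
      using independentD[OF B(3) B(1) subset_refl _ that, of ?c] by blast
    from this[of p] this[of q] pq show ?thesis by auto
  qed
  fix E assume E: "E \<in> sets M" "0 < emeasure M E \<and> emeasure M E < \<infinity>"
  then have "E \<in> fmeasurable M" by (auto simp: fmeasurable_def)
  from ex_function_level_sets_null_or_atom[OF this]
  obtain g :: "'a \<Rightarrow> real" where g[measurable]: "g \<in> borel_measurable M"
    and bound: "\<And>x. \<bar>g x\<bar> \<le> 3/2"
    and level: "\<And>c. {x\<in>E. g x = c} \<in> null_sets M \<or> is_atom M {x\<in>E. g x = c}"
    by blast
  note [measurable] = E(1)
  let ?f = "indicator E :: 'a \<Rightarrow> real"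
  let ?g = "\<lambda>x. indicator E x * g x"
  define u where "u x = ?f x *\<^sub>R p + ?g x *\<^sub>R q" for x
  have "integrable M ?f" using E by simp
  moreover have "integrable M ?g"
    using \<open>integrable M ?f\<close>
    by (rule Bochner_Integration.integrable_bound[OF integrable_mult_right[of "3/2"]])
       (use bound in \<open>auto split: split_indicator\<close>)
  ultimately have "u \<in> L1_tensor M"
    unfolding u_def L1_tensor_def by (auto intro: bochner_integrable_pair)
  moreover have "simple_limit M u"
    unfolding u_def by (rule simple_limit_scaleR_add) measurable
  ultimately obtain f :: "nat \<Rightarrow> 'a \<Rightarrow> 'k" and z
    where "AE x in M. u x \<noteq> 0 \<longrightarrow> (\<exists>i. f i x \<noteq> 0 \<and> u x = smul (f i x) (z i))"
    unfolding assms(3) by (elim disjoint_series_AE[OF assms(1), rotated])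
  then obtain N where N: "N \<in> null_sets M" "\<And>x. x \<in> space M - N \<Longrightarrow> u x \<noteq> 0 \<Longrightarrow> \<exists>i. f i x \<noteq> 0 \<and> u x = smul (f i x) (z i)"
    by (auto elim!: AE_E3)
  have u: "u x = smul 1 p + smul (of_real (g x)) q" if "x \<in> E" for x
    using that by (simp add: u_def scale_of_real)
  have u0: "u x \<noteq> 0" if "x \<in> E" for x
    using indep[of 1] u[OF that] by auto
  \<comment> \<open>Cross-multiplying removes \<open>v\<close>. As \<open>p\<close> has coefficient
    1 in both values of \<open>u\<close>, comparing the coefficients of \<open>p\<close> gives
    \<open>b = a\<close>, and those of \<open>q\<close> then give equal values of
    \<open>g\<close>.\<close>
  have same: "g x = g x'"
    if "x \<in> E" "x' \<in> E" "u x = smul a v" "u x' = smul b v" "a \<noteq> 0" "b \<noteq> 0" for x x' a b v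
  proof -
    have "smul b (u x) = smul a (u x')"
      using that by (simp add: mult.commute)
    then have "smul (b - a) p + smul (b * of_real (g x) - a * of_real (g x')) q = 0"
      using u that(1,2)
      by (simp add: scale_right_distrib scale_left_diff_distrib add_diff_add[symmetric])
    from indep[OF this] have "b = a" "b * of_real (g x) = a * of_real (g x')" by auto
    with \<open>a \<noteq> 0\<close> show ?thesis by simp
  qed
  \<comment> \<open>\<open>c i\<close> is the value of \<open>g\<close> at any one point of
    \<open>E\<close> where the \<open>i\<close>-th term alone gives \<open>u\<close>; by
    \<open>same\<close> the choice of the point is irrelevant. If there is no such point,
    \<open>c i\<close> is an unspecified value of \<open>g\<close>.\<close>
  define c where "c i = g (SOME x. x \<in> E \<and> f i x \<noteq> 0 \<and> u x = smul (f i x) (z i))" for i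
  have c: "g x = c i" if "x \<in> E" "f i x \<noteq> 0" "u x = smul (f i x) (z i)" for x i
  proof -
    have "\<exists>x. x \<in> E \<and> f i x \<noteq> 0 \<and> u x = smul (f i x) (z i)" using that by blast
    from someI_ex[OF this] that show ?thesis unfolding c_def by (blast intro: same)
  qed
  define L where "L i = {x\<in>E. g x = c i}" for i
  \<comment> \<open>A set rather than a sequence: several indices may yield the same level set.
    Those that are not null are atoms by \<open>level\<close>; the null ones join the exceptional
    set.\<close>
  define \<A> where "\<A> = {L i |i. L i \<notin> null_sets M}"
  have L_null: "L i \<in> null_sets M" if "L i \<notin> \<A>" for i
    using that by (auto simp: \<A>_def)
  have "countable \<A>"
    unfolding \<A>_def by (rule countable_subset[of _ "range L"]) auto
  have atoms: "is_atom M A \<and> A \<subseteq> E" if "A \<in> \<A>" for A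
    using that level by (auto simp: \<A>_def L_def)
  have "E - \<Union>\<A> \<subseteq> N \<union> (\<Union>i\<in>{i. L i \<notin> \<A>}. L i)"
  proof
    fix x assume x: "x \<in> E - \<Union>\<A>"
    show "x \<in> N \<union> (\<Union>i\<in>{i. L i \<notin> \<A>}. L i)"
    proof (cases "x \<in> N")
      case False
      then obtain i where "f i x \<noteq> 0" "u x = smul (f i x) (z i)"
        using N(2)[of x] u0[of x] x sets.sets_into_space[OF E(1)] by auto
      then have "x \<in> L i" using c x by (auto simp: L_def)
      then show ?thesis using x by auto
    qed simp
  qed
  moreover have "N \<union> (\<Union>i\<in>{i. L i \<notin> \<A>}. L i) \<in> null_sets M"
    using N(1) L_null by (intro null_sets.Un null_sets_UN') auto
  moreover have "\<Union>\<A> \<in> sets M"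
    using \<open>countable \<A>\<close> atoms by (intro sets.countable_Union) (auto simp: is_atom_def)
  ultimately have cover: "E - \<Union>\<A> \<in> null_sets M"
    using E(1) by (meson null_sets_subset sets.Diff)
  \<comment> \<open>An atom equivalent to no member of \<open>\<A>\<close> meets each of them in a
    null set. As countably many members cover \<open>E\<close> up to a null set, it would be null
    itself.\<close>
  have "\<exists>B\<in>\<A>. (A - B) \<union> (B - A) \<in> null_sets M" if A: "is_atom M A" "A \<subseteq> E" for A
  proof (rule ccontr)
    assume neg: "\<not> ?thesis"
    have "A \<inter> B \<in> null_sets M" if "B \<in> \<A>" for B
      using is_atom_Int_null_sets[of M A B] A atoms[OF that] neg that by blast
    then have "(\<Union>B\<in>\<A>. A \<inter> B) \<union> (E - \<Union>\<A>) \<in> null_sets M"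
      using cover \<open>countable \<A>\<close> by (intro null_sets.Un null_sets_UN') auto
    moreover have "A \<subseteq> (\<Union>B\<in>\<A>. A \<inter> B) \<union> (E - \<Union>\<A>)" using A by auto
    ultimately have "A \<in> null_sets M"
      using A unfolding is_atom_def by (meson null_sets_subset)
    then show False using A by (auto simp: is_atom_def null_sets_def)
  qed
  then show "purely_atomic_set M E"
    unfolding purely_atomic_set_def using \<open>countable \<A>\<close> atoms cover by blast
qed

section \<open>From pure atomicity to disjoint expansions\<close>

text \<open>On each of the finitely many level sets of \<open>s\<close>, the function is the
  continuous map \<open>norm (_ - v)\<close> composed with \<open>u\<close>; this avoids
  measurability of a difference in a non-separable space.\<close>

lemma borel_measurable_norm_diff_simple:
  fixes u :: "'a \<Rightarrow> 'b::real_normed_vector"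
  assumes [measurable]: "u \<in> borel_measurable M" and s: "simple_function M s"
  shows "(\<lambda>x. norm (u x - s x)) \<in> borel_measurable M"
proof -
  have "(\<lambda>x. (\<lambda>v x. norm (u x - v)) (s x) x) \<in> borel_measurable M"
  proof (rule measurable_compose_countable'[where I="s ` space M" and g=s and f="\<lambda>v x. norm (u x - v)"])
    show "s \<in> measurable M (count_space (s ` space M))"
      using s by (auto simp: simple_function_def measurable_count_space_eq2)
    show "countable (s ` space M)" using s by (auto simp: simple_function_def intro: countable_finite)
    show "(\<lambda>x. norm (u x - v)) \<in> borel_measurable M" for v
      by (rule measurable_compose[OF assms(1)])
         (intro borel_measurable_continuous_onI continuous_intros)
  qed
  then show ?thesis by simp
qed

text \<open>A single simple integrable function at \<open>L\<^sub>1\<close>-distance less than 1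
  suffices, by the triangle inequality.\<close>

lemma bochner_integrable_norm_finite:
  fixes u :: "'a \<Rightarrow> 'b::real_normed_vector"
  assumes "bochner_integrable M u"
  shows "(\<integral>\<^sup>+x. ennreal (norm (u x)) \<partial>M) < \<infinity>"
proof -
  obtain s where u[measurable]: "u \<in> borel_measurable M"
    and s: "\<And>i. Bochner_Integration.simple_bochner_integrable M (s i)"
    and lim: "(\<lambda>i. \<integral>\<^sup>+x. ennreal (norm (u x - s i x)) \<partial>M) \<longlonglongrightarrow> 0"
    using assms unfolding bochner_integrable_def by auto
  have sf: "simple_function M (s i)" for i
    using s[of i] by (auto elim!: Bochner_Integration.simple_bochner_integrable.cases)
  note [measurable] = borel_measurable_norm_diff_simple[OF u sf]
  have [measurable]: "(\<lambda>x. norm (s i x)) \<in> borel_measurable M" for i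
    by (rule borel_measurable_simple_function[OF simple_function_compose1[OF sf]])
  have "eventually (\<lambda>i. (\<integral>\<^sup>+x. ennreal (norm (u x - s i x)) \<partial>M) < 1) sequentially"
    using lim by (rule order_tendstoD) simp
  then obtain i where i: "(\<integral>\<^sup>+x. ennreal (norm (u x - s i x)) \<partial>M) < 1"
    by (auto simp: eventually_sequentially)
  have "Bochner_Integration.simple_bochner_integrable M (\<lambda>x. norm (s i x))"
    using Bochner_Integration.simple_bochner_integrable_compose2[of "\<lambda>a _. norm a", OF _ s[of i] s[of i]] by simp
  then have "integrable M (\<lambda>x. norm (s i x))"
    using Bochner_Integration.has_bochner_integral_simple_bochner_integrable by (blast intro: integrable.intros)
  then have fin: "(\<integral>\<^sup>+x. ennreal (norm (s i x)) \<partial>M) < \<infinity>"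
    by (simp add: integrable_iff_bounded)
  have "(\<integral>\<^sup>+x. ennreal (norm (u x)) \<partial>M) \<le>
      (\<integral>\<^sup>+x. ennreal (norm (u x - s i x)) + ennreal (norm (s i x)) \<partial>M)"
    by (intro nn_integral_mono)
       (metis diff_add_cancel ennreal_leI ennreal_plus norm_ge_zero norm_triangle_ineq)
  also have "\<dots> = (\<integral>\<^sup>+x. ennreal (norm (u x - s i x)) \<partial>M) + (\<integral>\<^sup>+x. ennreal (norm (s i x)) \<partial>M)"
    by (rule nn_integral_add) auto
  also have "\<dots> < \<infinity>"
    using less_trans[OF i ennreal_one_less_top] fin by simp
  finally show ?thesis .
qed

text \<open>For every \<open>e > 0\<close>, some ball of radius \<open>e\<close> contains the values
  of \<open>u\<close> on a non-null part of \<open>A\<close>, hence on almost all of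
  \<open>A\<close>. Shrinking the radius along \<open>1 / Suc k\<close> leaves only one
  value.\<close>

lemma bochner_integrable_AE_const_on_atom:
  fixes u :: "'a \<Rightarrow> 'b::real_normed_vector"
  assumes "bochner_integrable M u" and A: "is_atom M A"
  shows "\<exists>v. AE x in M. x \<in> A \<longrightarrow> u x = v"
proof -
  obtain s where u[measurable]: "u \<in> borel_measurable M"
    and s: "\<And>i. Bochner_Integration.simple_bochner_integrable M (s i)"
    and lim: "(\<lambda>i. \<integral>\<^sup>+x. ennreal (norm (u x - s i x)) \<partial>M) \<longlonglongrightarrow> 0"
    using assms unfolding bochner_integrable_def by auto
  have sf: "simple_function M (s i)" for i
    using s[of i] by (auto elim!: Bochner_Integration.simple_bochner_integrable.cases)
  note [measurable] = borel_measurable_norm_diff_simple[OF u sf]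
  have A'[measurable]: "A \<in> sets M" and pos: "0 < emeasure M A" and fin: "emeasure M A < \<infinity>"
    using A by (auto simp: is_atom_def)
  have [measurable]: "(\<lambda>x. norm (u x - v)) \<in> borel_measurable M" for v
    by (rule borel_measurable_norm_diff_simple[OF u]) simp
  have "\<exists>v. AE x in M. x \<in> A \<longrightarrow> norm (u x - v) < e" if "e > 0" for e :: real
  proof -
    have "eventually (\<lambda>i. (\<integral>\<^sup>+x. ennreal (norm (u x - s i x)) \<partial>M) < ennreal e * emeasure M A) sequentially"
      using lim that pos by (intro order_tendstoD(2)[OF lim]) (simp add: ennreal_zero_less_mult_iff)
    then obtain i where i: "(\<integral>\<^sup>+x. ennreal (norm (u x - s i x)) \<partial>M) < ennreal e * emeasure M A"
      by (auto simp: eventually_sequentially)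
    \<comment> \<open>Otherwise \<open>u\<close> would differ from \<open>s i\<close> by at least
      \<open>e\<close> almost everywhere on \<open>A\<close>, making the integral at least
      \<open>e\<close> times the measure of \<open>A\<close>, against the choice of
      \<open>i\<close>.\<close>
    have "\<exists>v\<in>s i ` space M. {x\<in>A. norm (u x - v) < e} \<notin> null_sets M"
    proof (rule ccontr)
      assume "\<not> ?thesis"
      then have "(\<Union>v\<in>s i ` space M. {x\<in>A. norm (u x - v) < e}) \<in> null_sets M"
        using sf[of i] by (intro null_sets_UN') (auto simp: simple_function_def countable_finite)
      from AE_not_in[OF this] have "AE x in M. x \<in> A \<longrightarrow> e \<le> norm (u x - s i x)"
        by (rule AE_mp) (auto intro!: AE_I2 simp: not_less)
      then have "(\<integral>\<^sup>+x. ennreal e * indicator A x \<partial>M) \<le> (\<integral>\<^sup>+x. ennreal (norm (u x - s i x)) \<partial>M)"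
        by (intro nn_integral_mono_AE) (auto split: split_indicator elim!: eventually_mono intro: ennreal_leI)
      with i show False by (simp add: nn_integral_cmult_indicator)
    qed
    then obtain v where v: "{x\<in>A. norm (u x - v) < e} \<notin> null_sets M" by auto
    have D: "{x\<in>A. norm (u x - v) < e} \<in> sets M"
    proof -
      have "{x\<in>A. norm (u x - v) < e} = A \<inter> {x\<in>space M. norm (u x - v) < e}"
        using sets.sets_into_space[OF A'] by auto
      then show ?thesis by simp
    qed
    with v have "emeasure M {x\<in>A. norm (u x - v) < e} \<noteq> 0"
      by (auto simp: null_sets_def)
    moreover have "{x\<in>A. norm (u x - v) < e} \<subseteq> A" by auto
    ultimately have "emeasure M {x\<in>A. norm (u x - v) < e} = emeasure M A"
      using A D unfolding is_atom_def by blast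
    then have "emeasure M (A - {x\<in>A. norm (u x - v) < e}) = 0"
      using D fin by (subst emeasure_Diff) auto
    then have "A - {x\<in>A. norm (u x - v) < e} \<in> null_sets M"
      using D by (intro null_setsI) auto
    from AE_not_in[OF this] show ?thesis
      by (intro exI[of _ v]) (auto elim!: eventually_mono)
  qed
  then have "\<forall>k. \<exists>v. AE x in M. x \<in> A \<longrightarrow> norm (u x - v) < 1 / real (Suc k)" by simp
  from choice[OF this]
  obtain v where "\<And>k. AE x in M. x \<in> A \<longrightarrow> norm (u x - v k) < 1 / real (Suc k)"
    by blast
  then have "AE x in M. \<forall>k. x \<in> A \<longrightarrow> norm (u x - v k) < 1 / real (Suc k)"
    unfolding AE_all_countable by blast
  then obtain N where N: "N \<in> null_sets M"
      "\<And>x k. x \<in> space M - N \<Longrightarrow> x \<in> A \<Longrightarrow> norm (u x - v k) < 1 / real (Suc k)"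
    by (elim AE_E3) auto
  \<comment> \<open>Positive measure provides a point \<open>x0\<close> outside the exceptional set;
    its value is the constant.\<close>
  have "\<not> A \<subseteq> N"
    using null_sets_subset[OF N(1) A'] pos by (auto simp: null_sets_def)
  then obtain x0 where x0: "x0 \<in> A" "x0 \<notin> N" by auto
  have sp: "A \<subseteq> space M" using A' by (rule sets.sets_into_space)
  have "u x = u x0" if "x \<in> A" "x \<notin> N" for x
  proof -
    \<comment> \<open>The centres converge to the value of \<open>u\<close> at every good point, so
      uniqueness of limits identifies all these values.\<close>
    have "v \<longlonglongrightarrow> u y" if y: "y \<in> A" "y \<notin> N" for y
    proof (rule metric_tendsto_imp_tendsto[OF LIMSEQ_inverse_real_of_nat])
      show "eventually (\<lambda>k. dist (v k) (u y) \<le> dist (inverse (real (Suc k))) 0) sequentially"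
        using N(2)[of y] y sp by (auto simp: dist_norm norm_minus_commute field_simps intro!: always_eventually less_imp_le)
    qed
    then show ?thesis using that x0 LIMSEQ_unique by blast
  qed
  then have "AE x in M. x \<in> A \<longrightarrow> u x = u x0"
    using AE_not_in[OF N(1)] by (auto elim!: eventually_mono)
  then show ?thesis ..
qed

text \<open>The support of \<open>u\<close> is the union of the sets \<open>E n\<close>, which have
  finite measure by Markov's inequality. Each is thus null or covered by countably many atoms up to
  a null set.\<close>

lemma purely_atomic_cover_support:
  fixes u :: "'a \<Rightarrow> 'b::real_normed_vector"
  assumes "purely_atomic M" and u: "bochner_integrable M u"
  obtains A :: "nat \<Rightarrow> 'a set" where "\<And>n. A n = {} \<or> is_atom M (A n)"
    "AE x in M. u x \<noteq> 0 \<longrightarrow> x \<in> (\<Union>n. A n)"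
proof -
  have [measurable]: "u \<in> borel_measurable M" using u by (simp add: bochner_integrable_def)
  define E where "E n = {x\<in>space M. 1 / real (Suc n) < norm (u x)}" for n
  have E[measurable]: "E n \<in> sets M" for n unfolding E_def by measurable
  have "\<exists>\<A>. countable \<A> \<and> (\<forall>A\<in>\<A>. is_atom M A) \<and> E n - \<Union>\<A> \<in> null_sets M" for n
  proof (cases "emeasure M (E n) = 0")
    case True
    then show ?thesis by (intro exI[of _ "{}"]) auto
  next
    case False
    \<comment> \<open>This rewriting brings \<open>E n\<close> into the form bounded by Markov's
      inequality.\<close>
    have "E n = {x\<in>E n. 1 \<le> ennreal (Suc n) * ennreal (norm (u x))}"
    proof -
      have "1 \<le> ennreal (Suc n) * ennreal (norm (u x))" if "x \<in> E n" for x
      proof -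
        have "1 \<le> real (Suc n) * norm (u x)" using that by (auto simp: E_def field_simps)
        then show ?thesis by (metis ennreal_1 ennreal_leI ennreal_mult' of_nat_0_le_iff)
      qed
      then show ?thesis by auto
    qed
    also have "emeasure M \<dots> \<le> ennreal (Suc n) * (\<integral>\<^sup>+x. ennreal (norm (u x)) * indicator (E n) x \<partial>M)"
      by (rule nn_integral_Markov_inequality) auto
    also have "\<dots> \<le> ennreal (Suc n) * (\<integral>\<^sup>+x. ennreal (norm (u x)) \<partial>M)"
      by (intro mult_left_mono nn_integral_mono) (auto split: split_indicator)
    also have "\<dots> < \<infinity>"
      using bochner_integrable_norm_finite[OF u] by (auto simp: ennreal_mult_less_top)
    finally have "purely_atomic_set M (E n)"
      using False assms(1) E by (auto simp: purely_atomic_def zero_less_iff_neq_zero)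
    then obtain \<A> where "countable \<A>" "\<forall>A\<in>\<A>. is_atom M A \<and> A \<subseteq> E n" "E n - \<Union>\<A> \<in> null_sets M"
      unfolding purely_atomic_set_def by (elim exE conjE)
    then show ?thesis by (intro exI[of _ \<A>]) simp
  qed
  then have "\<forall>n. \<exists>\<A>. countable \<A> \<and> (\<forall>A\<in>\<A>. is_atom M A) \<and> E n - \<Union>\<A> \<in> null_sets M"
    by blast
  from choice[OF this] obtain \<A> where
    "\<forall>n. countable (\<A> n) \<and> (\<forall>A\<in>\<A> n. is_atom M A) \<and> E n - \<Union>(\<A> n) \<in> null_sets M" ..
  then have \<A>: "\<And>n. countable (\<A> n)" "\<And>n A. A \<in> \<A> n \<Longrightarrow> is_atom M A"
      "\<And>n. E n - \<Union>(\<A> n) \<in> null_sets M"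
    by auto
  \<comment> \<open>The empty set keeps the family nonempty, so that \<open>from_nat_into\<close>
    enumerates it even when there are no atoms.\<close>
  define \<B> where "\<B> = insert {} (\<Union>n. \<A> n)"
  define A where "A = from_nat_into \<B>"
  have "countable \<B>" "\<B> \<noteq> {}" using \<A> by (auto simp: \<B>_def)
  then have range: "range A = \<B>" by (simp add: A_def range_from_nat_into)
  show ?thesis
  proof
    show "A n = {} \<or> is_atom M (A n)" for n
      using range \<A>(2) rangeI[of A n] by (auto simp: \<B>_def)
    have "AE x in M. \<forall>n. x \<notin> E n - \<Union>(\<A> n)"
      unfolding AE_all_countable using \<A>(3) AE_not_in by blast
    then show "AE x in M. u x \<noteq> 0 \<longrightarrow> x \<in> (\<Union>n. A n)"
      using AE_space
    proof eventually_elim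
      case (elim x)
      show ?case
      proof
        assume "u x \<noteq> 0"
        then obtain n where "1 / real (Suc n) < norm (u x)"
          using nat_approx_posE[of "norm (u x)"] by auto
        then have "x \<in> \<Union>(\<A> n)" using elim by (auto simp: E_def)
        then have "x \<in> \<Union>\<B>" by (auto simp: \<B>_def)
        then show "x \<in> (\<Union>n. A n)" by (simp add: range)
      qed
    qed
  qed
qed

lemma disjoint_series_if_purely_atomic:
  fixes smul :: "'k::{real_normed_field, second_countable_topology} \<Rightarrow> 'y::banach \<Rightarrow> 'y"
  assumes "banach_space_over smul" "purely_atomic M"
  shows "L1_tensor M = disjoint_series M smul"
proof
  interpret banach_space_over smul by fact
  show "disjoint_series M smul \<subseteq> L1_tensor M" by (auto simp: disjoint_series_def)
  show "L1_tensor M \<subseteq> disjoint_series M smul"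
  proof
    fix u :: "'a \<Rightarrow> 'y" assume u': "u \<in> L1_tensor M"
    then have u: "bochner_integrable M u" by (simp add: L1_tensor_def)
    then have [measurable]: "u \<in> borel_measurable M" by (simp add: bochner_integrable_def)
    obtain A :: "nat \<Rightarrow> 'a set" where A: "\<And>n. A n = {} \<or> is_atom M (A n)"
      and cover: "AE x in M. u x \<noteq> 0 \<longrightarrow> x \<in> (\<Union>n. A n)"
      using purely_atomic_cover_support[OF assms(2) u] by blast
    have A_fin: "A n \<in> sets M" "emeasure M (A n) < \<infinity>" for n
      using A[of n] by (auto simp: is_atom_def)
    have "\<exists>v. AE x in M. x \<in> A n \<longrightarrow> u x = v" for n
      using A[of n] bochner_integrable_AE_const_on_atom[OF u, of "A n"] by (cases "A n = {}") auto
    then have "\<forall>n. \<exists>v. AE x in M. x \<in> A n \<longrightarrow> u x = v" by blast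
    from choice[OF this] obtain y where y: "\<And>n. AE x in M. x \<in> A n \<longrightarrow> u x = y n" by blast
    \<comment> \<open>The enumerated atoms may overlap or repeat. The disjointed pieces need not be
      atoms, but they have finite measure and \<open>u\<close> is still almost everywhere constant
      on each, which is all that the expansion by indicators uses.\<close>
    define B where "B = disjointed A"
    have B_meas[measurable]: "B n \<in> sets M" for n
      using A_fin sets.range_disjointed_sets[of A M] by (auto simp: B_def)
    have B_sub: "B n \<subseteq> A n" for n unfolding B_def by (rule disjointed_subset)
    have B_disj: "i = j" if "x \<in> B i" "x \<in> B j" for x i j
      using disjoint_family_disjointed[of A] that unfolding B_def disjoint_family_on_def by blast
    have B_UN: "(\<Union>n. B n) = (\<Union>n. A n)" unfolding B_def by (rule UN_disjointed_eq)
    define f :: "nat \<Rightarrow> 'a \<Rightarrow> 'k" where "f n = indicator (B n)" for n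
    have "emeasure M (B n) < \<infinity>" for n
      using emeasure_mono[OF B_sub A_fin(1)] A_fin(2) by (rule le_less_trans)
    from has_bochner_integral_indicator[OF B_meas this, where c="1 :: 'k"]
    have "integrable M (\<lambda>x. indicator (B n) x *\<^sub>R (1 :: 'k))" for n
      by (blast intro: integrable.intros)
    moreover have "f n = (\<lambda>x. indicator (B n) x *\<^sub>R 1)" for n
      by (auto simp: f_def split: split_indicator)
    ultimately have int: "integrable M (f n)" for n by simp
    \<comment> \<open>After \<open>n\<close> terms the error is \<open>u\<close> outside the first
      \<open>n\<close> pieces and zero on them.\<close>
    have AE: "AE x in M. ennreal (norm (u x - (\<Sum>i<n. elem_tensor smul (f i) (y i) x))) =
        (if x \<in> (\<Union>i<n. B i) then 0 else ennreal (norm (u x)))" for n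
    proof -
      have "AE x in M. \<forall>i. x \<in> A i \<longrightarrow> u x = y i"
        unfolding AE_all_countable using y by blast
      then show ?thesis
      proof eventually_elim
        case (elim x)
        have summand: "elem_tensor smul (f i) (y i) x = (if x \<in> B i then u x else 0)" for i
          using elim B_sub[of i] by (auto simp: elem_tensor_def f_def)
        show ?case
        proof (cases "x \<in> (\<Union>i<n. B i)")
          case True
          then obtain j where j: "j < n" "x \<in> B j" by auto
          then have "(\<Sum>i<n. elem_tensor smul (f i) (y i) x) = (\<Sum>i<n. if i = j then u x else 0)"
            by (intro sum.cong) (auto simp: summand dest: B_disj)
          then show ?thesis using True j by simp
        next
          case False
          then show ?thesis by (simp add: summand)
        qed
      qed
    qed
    \<comment> \<open>Dominated convergence with majorant \<open>norm (u x)\<close>: at almost every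
      point, either \<open>u\<close> vanishes or the point lies in some \<open>B m\<close> and the
      error is zero for all \<open>n > m\<close>.\<close>
    have "(\<lambda>n. \<integral>\<^sup>+x. (if x \<in> (\<Union>i<n. B i) then 0 else ennreal (norm (u x))) \<partial>M) \<longlonglongrightarrow> (\<integral>\<^sup>+x. 0 \<partial>M)"
    proof (rule nn_integral_dominated_convergence[where w="\<lambda>x. ennreal (norm (u x))"])
      show "(\<integral>\<^sup>+x. ennreal (norm (u x)) \<partial>M) < \<infinity>" by (rule bochner_integrable_norm_finite[OF u])
      show "AE x in M. (\<lambda>n. if x \<in> (\<Union>i<n. B i) then 0 else ennreal (norm (u x))) \<longlonglongrightarrow> 0"
        using cover
      proof eventually_elim
        case (elim x)
        show ?case
        proof (cases "u x = 0")
          case True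
          show ?thesis unfolding True by (simp cong: if_cong)
        next
          case False
          then have "x \<in> (\<Union>n. B n)" using elim B_UN by simp
          then obtain m where "x \<in> B m" by blast
          then show ?thesis
            by - (rule tendsto_eventually, rule eventually_mono[OF eventually_gt_at_top[of m]], auto)
        qed
      qed
    qed auto
    then have "(\<lambda>n. \<integral>\<^sup>+x. ennreal (norm (u x - (\<Sum>i<n. elem_tensor smul (f i) (y i) x))) \<partial>M) \<longlonglongrightarrow> 0"
      by (simp add: nn_integral_cong_AE[OF AE])
    moreover have "emeasure M (supp M (f i) \<inter> supp M (f j)) = 0" if "i \<noteq> j" for i j
    proof -
      have "supp M (f i) \<inter> supp M (f j) = {}"
        using that B_disj by (auto simp: supp_def f_def indicator_def split: if_splits)
      then show ?thesis by simp
    qed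
    ultimately show "u \<in> disjoint_series M smul"
      unfolding disjoint_series_def using u' int by blast
  qed
qed

theorem theorem3p8:
  fixes M :: "'a measure"
    and scaleC :: "complex \<Rightarrow> 'z::banach \<Rightarrow> 'z"
  shows "(dim_ge (scaleR :: real \<Rightarrow> 'y::banach \<Rightarrow> 'y) 2 \<longrightarrow>
            (L1_tensor M = disjoint_series M (scaleR :: real \<Rightarrow> 'y \<Rightarrow> 'y)
               \<longleftrightarrow> purely_atomic M)) \<and>
         (banach_space_over scaleC \<and> dim_ge scaleC 2 \<longrightarrow>
            (L1_tensor M = disjoint_series M scaleC \<longleftrightarrow> purely_atomic M))"
proof (intro conjI impI)
  show "L1_tensor M = disjoint_series M (scaleR :: real \<Rightarrow> 'y \<Rightarrow> 'y) \<longleftrightarrow> purely_atomic M"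
    if "dim_ge (scaleR :: real \<Rightarrow> 'y \<Rightarrow> 'y) 2"
    by (rule iffI[OF purely_atomic_if_disjoint_series[OF banach_space_over_scaleR that]
        disjoint_series_if_purely_atomic[OF banach_space_over_scaleR]])
  show "L1_tensor M = disjoint_series M scaleC \<longleftrightarrow> purely_atomic M"
    if "banach_space_over scaleC \<and> dim_ge scaleC 2"
    by (rule iffI[OF purely_atomic_if_disjoint_series[OF conjunct1[OF that] conjunct2[OF that]]
        disjoint_series_if_purely_atomic[OF conjunct1[OF that]]])
qed

end
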